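(* Let $G$ be a locally compact group. Then any homogeneous quasi-morphism $\varphi:G\to\mathbf{Z}$ is continuous.
   Context: A quasi-morphism of a group $G$ is a map $f:G\to\mathbf{R}$ with $\sup_{g,h\in G}|f(gh)-f(g)-f(h)|<\infty$; it is homogeneous if its restriction to every cyclic subgroup is a homomorphism. A homogeneous quasi-morphism $G\to\mathbf{Z}$ is one taking integer values; no continuity or measurability is assumed. $\mathbf{Z}$ is discrete. *)

theory Defs
  imports "HOL-Algebra.Algebra" "HOL-Analysis.Analysis"
begin

locale topological_group = group G for G (structure) +
  fixes T :: "'a topology"
  assumes topspace_eq_carrier: "topspace T = carrier G"
    and continuous_mult: "continuous_map (prod_topology T T) T (\<lambda>(x, y). x \<otimes> y)"
    and continuous_inv: "continuous_map T T (\<lambda>x. inv x)"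

(* Locally compact groups are Hausdorff by the usual convention. The assumption is needed for
   automatic continuity: an infinite cyclic group with the indiscrete topology is compact but
   has a discontinuous isomorphism onto the discrete integers. *)
locale locally_compact_group = topological_group +
  assumes Hausdorff: "Hausdorff_space T"
    and locally_compact: "locally_compact_space T"

definition quasi_morphism :: "('a, 'b) monoid_scheme \<Rightarrow> ('a \<Rightarrow> real) \<Rightarrow> bool" where
  "quasi_morphism G f \<longleftrightarrow>
     bdd_above {\<bar>f (g \<otimes>\<^bsub>G\<^esub> h) - f g - f h\<bar> | g h. g \<in> carrier G \<and> h \<in> carrier G}"

definition homogeneous_quasi_morphism :: "('a, 'b) monoid_scheme \<Rightarrow> ('a \<Rightarrow> real) \<Rightarrow> bool" where
  "homogeneous_quasi_morphism G f \<longleftrightarrow>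
     quasi_morphism G f \<and>
     (\<forall>g\<in>carrier G. \<forall>x\<in>generate G {g}. \<forall>y\<in>generate G {g}. f (x \<otimes>\<^bsub>G\<^esub> y) = f x + f y)"

end

theory Submission
  imports Defs
begin

text \<open>
  The proof adapts Dudley's automatic continuity argument for homomorphisms to quasi-morphisms.
  Let \<open>D\<close> bound the defect of \<open>\<phi>\<close>.

  It suffices that \<open>\<phi>\<close> is bounded, say by \<open>C\<close>, on some neighbourhood \<open>U\<close> of the identity. Indeed,
  fix \<open>g\<close> and \<open>k > D + C\<close>. For \<open>x\<close> near \<open>g\<close> one has \<open>g\<^sup>-\<^sup>k x\<^sup>k \<in> U\<close>, hence
  \<open>k \<bar>\<phi>(x) - \<phi>(g)\<bar> = \<bar>\<phi>(x\<^sup>k) - \<phi>(g\<^sup>k)\<bar> \<le> D + C < k\<close>, and integers at distance less than 1 agree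
  (\<open>qm_continuous_if_bounded_near_one\<close>).

  Suppose that \<open>\<bar>\<phi>\<bar>\<close> exceeds \<open>D\<close> arbitrarily close to the identity. Choose such points \<open>x\<^sub>0, x\<^sub>1, \<dots>\<close>
  so close to the identity that, with exponents \<open>r\<^sub>n = \<bar>\<phi>(x\<^sub>n)\<bar> + D + 2\<close>, the infinite
  nested product \<open>y\<^sub>0 = x\<^sub>0 (x\<^sub>1 (x\<^sub>2 \<dots>)\<^bsup>r\<^sub>1\<^esup>)\<^bsup>r\<^sub>0\<^esup>\<close> makes sense: local compactness supplies points
  with \<open>y\<^sub>n = x\<^sub>n y\<^sub>n\<^sub>+\<^sub>1\<^bsup>r\<^sub>n\<^esup>\<close> for all \<open>n\<close> (\<open>compact_recursion_solvable\<close>). Then \<open>\<phi>(y\<^sub>n)\<close> differs from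
  \<open>\<phi>(x\<^sub>n) + r\<^sub>n \<phi>(y\<^sub>n\<^sub>+\<^sub>1)\<close> by at most \<open>D\<close>, and no sequence of integers can satisfy this
  (\<open>no_expanding_integer_recursion\<close>).
\<close>

section \<open>Two facts about infinite recursions\<close>

text \<open>
  Starting a recursion at a late index and computing backwards yields points that satisfy its first
  \<open>N\<close> equations; by compactness of a countable power of \<open>K\<close>, these closed conditions have a common
  solution. The sets \<open>W n\<close> serve to keep the finite approximations inside \<open>K\<close>.
\<close>
lemma compact_recursion_solvable:
  fixes F :: "nat \<Rightarrow> 'a \<Rightarrow> 'a"
  assumes "Hausdorff_space T" and "compactin T K"
    and cont: "\<And>n. continuous_map T T (F n)"
    and WK: "\<And>n. W n \<subseteq> K" and W_ne: "\<And>n. W n \<noteq> {}"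
    and step: "\<And>n w. w \<in> W (Suc n) \<Longrightarrow> F n w \<in> W n"
  shows "\<exists>y. \<forall>n. y n \<in> K \<and> y n = F n (y (Suc n))"
proof -
  define Z where "Z = product_topology (\<lambda>_::nat. subtopology T K) UNIV"
  have "K \<subseteq> topspace T"
    using assms(2) by (rule compactin_subset_topspace)
  then have topX: "y \<in> topspace Z \<longleftrightarrow> (\<forall>n. y n \<in> K)" for y
    by (auto simp: Z_def PiE_iff)
  define C where "C N = {y \<in> topspace Z. \<forall>i<N. y i = F i (y (Suc i))}" for N
  have "compact_space Z"
    unfolding Z_def using assms(2) by (simp add: compact_space_product_topology compact_space_subtopology)
  moreover have "closedin Z (C N)" for N
  proof -
    have proj: "continuous_map Z T (\<lambda>y. y i)" for i
      using continuous_map_product_projection[of i UNIV "\<lambda>_. subtopology T K"]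
      by (auto simp: Z_def intro: continuous_map_into_fulltopology)
    have "closedin Z {y \<in> topspace Z. y i = F i (y (Suc i))}" for i
      using continuous_map_compose[OF proj[of "Suc i"] cont[of i]]
      by (intro closedin_continuous_maps_eq[OF assms(1) proj]) (simp add: o_def)
    then have "closedin Z (topspace Z \<inter> (\<Inter>i\<in>{..<N}. {y \<in> topspace Z. y i = F i (y (Suc i))}))"
      by (cases "N = 0") (auto intro!: closedin_Int closedin_INT)
    moreover have "C N = topspace Z \<inter> (\<Inter>i\<in>{..<N}. {y \<in> topspace Z. y i = F i (y (Suc i))})"
      by (auto simp: C_def)
    ultimately show ?thesis by simp
  qed
  moreover have "C N \<noteq> {}" for N
  proof -
    have "\<exists>z. (\<forall>i. z i \<in> W i) \<and> (\<forall>i. m \<le> i \<and> i < N \<longrightarrow> z i = F i (z (Suc i)))" if "m \<le> N" for m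
      using that
    proof (induction rule: inc_induct)
      case base
      have "\<exists>z. \<forall>i. z i \<in> W i"
        using W_ne by (intro choice) blast
      then show ?case by auto
    next
      case (step m)
      then obtain z where z: "\<And>i. z i \<in> W i" "\<And>i. Suc m \<le> i \<Longrightarrow> i < N \<Longrightarrow> z i = F i (z (Suc i))"
        by auto
      have "(z(m := F m (z (Suc m)))) i \<in> W i" for i
        using z(1) assms(6) by simp
      moreover have "(z(m := F m (z (Suc m)))) i = F i ((z(m := F m (z (Suc m)))) (Suc i))"
        if "m \<le> i" "i < N" for i
        using z(2)[of i] that by auto
      ultimately show ?case by blast
    qed
    from this[of 0] obtain z where "\<And>i. z i \<in> W i" "\<And>i. i < N \<Longrightarrow> z i = F i (z (Suc i))"
      by auto
    then have "z \<in> C N"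
      using WK by (auto simp: C_def topX)
    then show ?thesis by auto
  qed
  moreover have "decseq C"
    by (auto simp: decseq_def C_def)
  ultimately have "(\<Inter>n. C n) \<noteq> {}"
    by (rule compact_space_imp_nest)
  then obtain y where y: "\<And>N. y \<in> C N"
    by auto
  have "y n \<in> K \<and> y n = F n (y (Suc n))" for n
    using y[of "Suc n"] lessI[of n] unfolding C_def mem_Collect_eq topX by blast
  then show ?thesis by blast
qed

text \<open>
  Going down one index strictly increases \<open>\<bar>a n\<bar>\<close> as soon as it is nonzero, so
  \<open>a (n + 1) \<noteq> 0\<close> would force \<open>\<bar>a 0\<bar> \<ge> n + 2\<close>. Hence \<open>a\<close> vanishes eventually, and then
  \<open>\<bar>b n\<bar> \<le> D\<close>.
\<close>
lemma no_expanding_integer_recursion: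
  fixes a b r :: "nat \<Rightarrow> int" and D :: int
  assumes rec: "\<And>n. \<bar>a n - b n - r n * a (Suc n)\<bar> \<le> D"
    and b: "\<And>n. \<bar>b n\<bar> > D" and r: "\<And>n. r n \<ge> \<bar>b n\<bar> + D + 2"
  shows False
proof -
  have "D \<ge> 0"
    using rec[of 0] by linarith
  have grow: "\<bar>a n\<bar> \<ge> \<bar>a (Suc n)\<bar> + 1" if "a (Suc n) \<noteq> 0" for n
  proof -
    have "r n \<ge> 1"
      using r[of n] \<open>D \<ge> 0\<close> by linarith
    then have "(r n - 1) * (\<bar>a (Suc n)\<bar> - 1) \<ge> 0"
      using that by (intro mult_nonneg_nonneg) auto
    then have "r n * \<bar>a (Suc n)\<bar> \<ge> r n + \<bar>a (Suc n)\<bar> - 1"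
      by (simp add: algebra_simps)
    moreover have "\<bar>r n * a (Suc n)\<bar> = r n * \<bar>a (Suc n)\<bar>"
      using \<open>r n \<ge> 1\<close> by (simp add: abs_mult)
    ultimately show ?thesis
      using rec[of n] r[of n] by linarith
  qed
  have descend: "\<bar>a 0\<bar> \<ge> \<bar>a n\<bar> + int n" if "a n \<noteq> 0" for n
    using that
  proof (induction n)
    case (Suc n)
    from grow[OF Suc.prems] show ?case
      using Suc.IH by fastforce
  qed simp
  have "a n = 0" if "n \<ge> nat \<bar>a 0\<bar>" for n
    using descend[of n] that by linarith
  from this[of "nat \<bar>a 0\<bar>"] this[of "Suc (nat \<bar>a 0\<bar>)"] show False
    using rec[of "nat \<bar>a 0\<bar>"] b[of "nat \<bar>a 0\<bar>"] by simp
qed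

section \<open>Quasi-morphisms and powers\<close>

lemma quasi_morphism_int_defect:
  fixes \<phi> :: "'a \<Rightarrow> int"
  assumes "quasi_morphism G (\<lambda>g. real_of_int (\<phi> g))"
  shows "\<exists>D. \<forall>g\<in>carrier G. \<forall>h\<in>carrier G. \<bar>\<phi> (g \<otimes>\<^bsub>G\<^esub> h) - \<phi> g - \<phi> h\<bar> \<le> D"
proof -
  from assms obtain M :: real where M:
    "\<And>g h. g \<in> carrier G \<Longrightarrow> h \<in> carrier G \<Longrightarrow>
      \<bar>real_of_int (\<phi> (g \<otimes>\<^bsub>G\<^esub> h)) - real_of_int (\<phi> g) - real_of_int (\<phi> h)\<bar> \<le> M"
    unfolding quasi_morphism_def bdd_above_def by blast
  have "\<bar>\<phi> (g \<otimes>\<^bsub>G\<^esub> h) - \<phi> g - \<phi> h\<bar> \<le> \<lfloor>M\<rfloor>" if "g \<in> carrier G" "h \<in> carrier G" for g h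
    using M[OF that] by (simp add: le_floor_iff)
  then show ?thesis by blast
qed

lemma (in group) homogeneous_quasi_morphism_pow:
  assumes hom: "homogeneous_quasi_morphism G f" and g: "g \<in> carrier G"
  shows "f (g [^] (k::nat)) = real k * f g"
proof -
  have add: "f (x \<otimes> y) = f x + f y" if "x \<in> generate G {g}" "y \<in> generate G {g}" for x y
    using hom g that unfolding homogeneous_quasi_morphism_def by blast
  have pow_in: "g [^] n \<in> generate G {g}" for n :: nat
    using g by (induction n) (auto intro: generate.intros)
  show ?thesis
  proof (induction k)
    case 0
    show ?case
      using add[of \<one> \<one>] by (simp add: generate.one)
  next
    case (Suc k)
    then show ?case
      using add[OF pow_in[of k], of g] by (simp add: generate.incl algebra_simps)
  qed
qed

lemma (in group) homogeneous_quasi_morphism_int_pow: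
  fixes \<phi> :: "'a \<Rightarrow> int"
  assumes "homogeneous_quasi_morphism G (\<lambda>g. real_of_int (\<phi> g))" and "g \<in> carrier G"
  shows "\<phi> (g [^] (k::nat)) = int k * \<phi> g"
proof -
  have "real_of_int (\<phi> (g [^] k)) = real_of_int (int k * \<phi> g)"
    using homogeneous_quasi_morphism_pow[OF assms, of k] by simp
  then show ?thesis
    by (simp only: of_int_eq_iff)
qed

context topological_group
begin

lemma continuous_map_mult:
  assumes "continuous_map Z T f" "continuous_map Z T g"
  shows "continuous_map Z T (\<lambda>x. f x \<otimes> g x)"
  using continuous_map_compose[OF continuous_map_pairedI[OF assms] continuous_mult]
  by (simp add: o_def)

lemma continuous_map_pow: "continuous_map T T (\<lambda>x. x [^] (k::nat))"
  by (induction k) (auto simp: topspace_eq_carrier intro!: continuous_map_mult)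

lemma continuous_map_mult_pow:
  assumes "a \<in> carrier G"
  shows "continuous_map T T (\<lambda>x. a \<otimes> x [^] (k::nat))"
  using assms by (intro continuous_map_mult continuous_map_pow) (simp add: topspace_eq_carrier)

text \<open>
  Homogeneity multiplies the difference of two values by \<open>k\<close>, whereas the error caused by the
  defect and by the bound \<open>C\<close> stays below \<open>k\<close>.
\<close>
lemma qm_continuous_if_bounded_near_one:
  fixes \<phi> :: "'a \<Rightarrow> int"
  assumes hom: "homogeneous_quasi_morphism G (\<lambda>g. real_of_int (\<phi> g))"
    and U: "openin T U" "\<one> \<in> U" and bound: "\<And>u. u \<in> U \<Longrightarrow> \<bar>\<phi> u\<bar> \<le> C"
  shows "continuous_map T (discrete_topology UNIV) \<phi>"
proof -
  have "quasi_morphism G (\<lambda>g. real_of_int (\<phi> g))"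
    using hom unfolding homogeneous_quasi_morphism_def by (rule conjunct1)
  then obtain D where D: "\<And>g h. g \<in> carrier G \<Longrightarrow> h \<in> carrier G \<Longrightarrow> \<bar>\<phi> (g \<otimes> h) - \<phi> g - \<phi> h\<bar> \<le> D"
    using quasi_morphism_int_defect[of G \<phi>] by auto
  note pow = homogeneous_quasi_morphism_int_pow[OF hom]
  define k where "k = nat (D + C + 1)"
  have k: "int k > D + C"
    by (simp add: k_def)
  have loc: "\<exists>V. openin T V \<and> g \<in> V \<and> (\<forall>x\<in>V. \<phi> x = \<phi> g)" if g: "g \<in> carrier G" for g
  proof -
    define V where "V = {x \<in> topspace T. inv (g [^] k) \<otimes> x [^] k \<in> U}"
    have "openin T V"
      unfolding V_def using g U(1)
      by (intro openin_continuous_map_preimage[OF continuous_map_mult_pow]) auto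
    moreover have "g \<in> V"
      using g U(2) by (simp add: V_def topspace_eq_carrier)
    moreover have "\<phi> x = \<phi> g" if "x \<in> V" for x
    proof -
      from that have x: "x \<in> carrier G" and u: "inv (g [^] k) \<otimes> x [^] k \<in> U"
        by (auto simp: V_def topspace_eq_carrier)
      have "g [^] k \<otimes> (inv (g [^] k) \<otimes> x [^] k) = x [^] k"
        using g x m_assoc[of "g [^] k" "inv (g [^] k)" "x [^] k"] by simp
      then have "\<bar>int k * (\<phi> x - \<phi> g)\<bar> \<le> D + C"
        using D[of "g [^] k" "inv (g [^] k) \<otimes> x [^] k"] bound[OF u] g x
        by (simp add: pow right_diff_distrib)
      then have "int k * \<bar>\<phi> x - \<phi> g\<bar> < int k * 1"
        using k by (simp add: abs_mult)
      then have "\<bar>\<phi> x - \<phi> g\<bar> < 1"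
        by (rule mult_left_less_imp_less) simp
      then show ?thesis by simp
    qed
    ultimately show ?thesis by blast
  qed
  have "openin T {x \<in> topspace T. \<phi> x \<in> S}" for S
  proof (subst openin_subopen, intro ballI)
    fix g assume "g \<in> {x \<in> topspace T. \<phi> x \<in> S}"
    then have g: "g \<in> carrier G" "\<phi> g \<in> S"
      by (auto simp: topspace_eq_carrier)
    from loc[OF g(1)] obtain V where V: "openin T V" "g \<in> V" and eq: "\<forall>x\<in>V. \<phi> x = \<phi> g"
      by blast
    have "\<phi> x \<in> S" if "x \<in> V" for x
      unfolding bspec[OF eq that] by (rule g(2))
    then have "V \<subseteq> {x \<in> topspace T. \<phi> x \<in> S}"
      using openin_subset[OF V(1)] by blast
    with V show "\<exists>V. openin T V \<and> g \<in> V \<and> V \<subseteq> {x \<in> topspace T. \<phi> x \<in> S}"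
      by blast
  qed
  then show ?thesis
    by (simp add: continuous_map_def)
qed

end

section \<open>Boundedness near the identity\<close>

context locally_compact_group
begin

lemma qm_bounded_near_one:
  fixes \<phi> :: "'a \<Rightarrow> int"
  assumes hom: "homogeneous_quasi_morphism G (\<lambda>g. real_of_int (\<phi> g))"
  obtains U D where "openin T U" "\<one> \<in> U" "\<And>u. u \<in> U \<Longrightarrow> \<bar>\<phi> u\<bar> \<le> D"
proof -
  have "quasi_morphism G (\<lambda>g. real_of_int (\<phi> g))"
    using hom unfolding homogeneous_quasi_morphism_def by (rule conjunct1)
  then obtain D where D: "\<And>g h. g \<in> carrier G \<Longrightarrow> h \<in> carrier G \<Longrightarrow> \<bar>\<phi> (g \<otimes> h) - \<phi> g - \<phi> h\<bar> \<le> D"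
    using quasi_morphism_int_defect[of G \<phi>] by auto
  have "D \<ge> 0"
    using D[of \<one> \<one>] by simp
  note pow = homogeneous_quasi_morphism_int_pow[OF hom]
  have "\<exists>U. openin T U \<and> \<one> \<in> U \<and> (\<forall>u\<in>U. \<bar>\<phi> u\<bar> \<le> D)"
  proof (rule ccontr)
    assume "\<nexists>U. openin T U \<and> \<one> \<in> U \<and> (\<forall>u\<in>U. \<bar>\<phi> u\<bar> \<le> D)"
    then have large: "\<exists>x\<in>U. \<bar>\<phi> x\<bar> > D" if "openin T U" "\<one> \<in> U" for U
      using that by (meson not_le)
    have "\<one> \<in> topspace T"
      by (simp add: topspace_eq_carrier)
    then obtain O' K where O': "openin T O'" "\<one> \<in> O'" "O' \<subseteq> K" and K: "compactin T K"
      using locally_compact unfolding locally_compact_space_def by blast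
    have "K \<subseteq> carrier G"
      using compactin_subset_topspace[OF K] by (simp add: topspace_eq_carrier)
    define r where "r x = nat (\<bar>\<phi> x\<bar> + D + 2)" for x
    define good where "good = (\<lambda>(W, x). openin T W \<and> \<one> \<in> W \<and> W \<subseteq> K \<and> x \<in> W \<and> \<bar>\<phi> x\<bar> > D)"
    \<comment> \<open>The exponent depends only on the point, so the next neighbourhood can be chosen after it.\<close>
    have "\<exists>s :: nat \<Rightarrow> 'a set \<times> 'a. \<forall>n. good (s n) \<and>
        (\<forall>w\<in>fst (s (Suc n)). snd (s n) \<otimes> w [^] r (snd (s n)) \<in> fst (s n))"
    proof (rule dependent_nat_choice)
      show "\<exists>p. good p"
        using large[OF O'(1,2)] O' by (auto simp: good_def)
    next
      fix p :: "'a set \<times> 'a" and n :: nat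
      assume "good p"
      obtain W x where p: "p = (W, x)"
        by (cases p)
      with \<open>good p\<close> have W: "openin T W" "\<one> \<in> W" "W \<subseteq> K" "x \<in> W" "\<bar>\<phi> x\<bar> > D"
        by (auto simp: good_def)
      then have x: "x \<in> carrier G"
        using \<open>K \<subseteq> carrier G\<close> by auto
      define W' where "W' = O' \<inter> {w \<in> topspace T. x \<otimes> w [^] r x \<in> W}"
      have W': "openin T W'" "\<one> \<in> W'" "W' \<subseteq> K"
        unfolding W'_def using W x O' \<open>\<one> \<in> topspace T\<close>
          openin_continuous_map_preimage[OF continuous_map_mult_pow[OF x, of "r x"] W(1)]
        by auto
      from large[OF W'(1,2)] obtain x' where "x' \<in> W'" "\<bar>\<phi> x'\<bar> > D"
        by blast
      then have "good (W', x') \<and> (\<forall>w\<in>fst (W', x'). snd p \<otimes> w [^] r (snd p) \<in> fst p)"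
        using W' by (auto simp: good_def p W'_def)
      then show "\<exists>q. good q \<and> (\<forall>w\<in>fst q. snd p \<otimes> w [^] r (snd p) \<in> fst p)"
        by blast
    qed
    then obtain s where good: "\<And>n. good (s n)"
      and nest: "\<And>n w. w \<in> fst (s (Suc n)) \<Longrightarrow> snd (s n) \<otimes> w [^] r (snd (s n)) \<in> fst (s n)"
      by blast
    define W where "W n = fst (s n)" for n
    define x where "x n = snd (s n)" for n
    have W: "W n \<subseteq> K" "\<one> \<in> W n" and x: "x n \<in> K" "\<bar>\<phi> (x n)\<bar> > D" for n
      using good[of n] by (auto simp: good_def W_def x_def split: prod.splits)
    have xG: "x n \<in> carrier G" for n
      using x(1) \<open>K \<subseteq> carrier G\<close> by auto
    have "\<exists>y. \<forall>n. y n \<in> K \<and> y n = x n \<otimes> y (Suc n) [^] r (x n)"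
      by (rule compact_recursion_solvable[OF Hausdorff K continuous_map_mult_pow[OF xG] W(1)])
        (use W(2) nest in \<open>auto simp: W_def x_def\<close>)
    then obtain y where y: "\<And>n. y n \<in> K" "\<And>n. y n = x n \<otimes> y (Suc n) [^] r (x n)"
      by blast
    have "\<bar>\<phi> (y n) - \<phi> (x n) - int (r (x n)) * \<phi> (y (Suc n))\<bar> \<le> D" for n
    proof -
      have "y (Suc n) \<in> carrier G"
        using y(1) \<open>K \<subseteq> carrier G\<close> by auto
      then show ?thesis
        using D[OF xG[of n], of "y (Suc n) [^] r (x n)"] y(2)[of n] by (simp add: pow)
    qed
    then show False
      by (rule no_expanding_integer_recursion[where b = "\<lambda>n. \<phi> (x n)"])
        (use x(2) \<open>D \<ge> 0\<close> in \<open>auto simp: r_def\<close>)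
  qed
  then show ?thesis
    using that by blast
qed

end

theorem theoremA1:
  fixes G :: "('a, 'b) monoid_scheme" and T :: "'a topology" and \<phi> :: "'a \<Rightarrow> int"
  assumes "locally_compact_group G T"
    and "homogeneous_quasi_morphism G (\<lambda>g. real_of_int (\<phi> g))"
  shows "continuous_map T (discrete_topology UNIV) \<phi>"
proof -
  interpret locally_compact_group G T
    by fact
  obtain U D where "openin T U" "\<one>\<^bsub>G\<^esub> \<in> U" "\<And>u. u \<in> U \<Longrightarrow> \<bar>\<phi> u\<bar> \<le> D"
    using qm_bounded_near_one[OF assms(2)] by blast
  then show ?thesis
    by (rule qm_continuous_if_bounded_near_one[OF assms(2)])
qed

end
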